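(* Let $f$ be a continuous map of a separable metric space $X$ which admits a positively pointwise expansive outer regular measure. Then $f$ has uncountably many stable classes.
   Context: Let $(X,d)$ be a metric space and $f:X\to X$ a measurable map. A Borel measure $\mu$ is non-atomic if $\mu(\{x\})=0$ for every $x\in X$. For $\delta>0$, $\Phi_\delta(x)=\{y\in X:d(f^n(x),f^n(y))\le\delta\text{ for all integers }n\ge0\}$. A non-atomic Borel measure $\mu$ on $X$ is positively pointwise expansive for $f$ if for each $x\in X$ there is $\delta_x>0$ with $\mu(\Phi_{\delta_x}(x))=0$. The stable set of $x$ is $W^s(x)=\{y\in X:\text{for all }\epsilon>0\text{ there is }n\in\mathbb{N}\text{ with }d(f^i(x),f^i(y))\le\epsilon\text{ for all }i\ge n\}$; the sets $W^s(x)$, $x\in X$, partition $X$ and are called the stable classes of $f$. *)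

theory Defs
  imports "HOL-Analysis.Analysis"
begin

definition Phi :: "('a::metric_space \<Rightarrow> 'a) \<Rightarrow> real \<Rightarrow> 'a \<Rightarrow> 'a set" where
  "Phi f \<delta> x = {y. \<forall>n::nat. dist ((f ^^ n) x) ((f ^^ n) y) \<le> \<delta>}"

definition stable_set :: "('a::metric_space \<Rightarrow> 'a) \<Rightarrow> 'a \<Rightarrow> 'a set" where
  "stable_set f x =
    {y. \<forall>\<epsilon>>0. \<exists>n::nat. \<forall>i\<ge>n. dist ((f ^^ i) x) ((f ^^ i) y) \<le> \<epsilon>}"

definition stable_classes :: "('a::metric_space \<Rightarrow> 'a) \<Rightarrow> 'a set set" where
  "stable_classes f = range (stable_set f)"

definition borel_measure :: "'a::topological_space measure \<Rightarrow> bool" where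
  "borel_measure \<mu> \<longleftrightarrow> sets \<mu> = sets borel"

definition non_atomic :: "'a measure \<Rightarrow> bool" where
  "non_atomic \<mu> \<longleftrightarrow> (\<forall>x. emeasure \<mu> {x} = 0)"

definition outer_regular_measure :: "'a::topological_space measure \<Rightarrow> bool" where
  "outer_regular_measure \<mu> \<longleftrightarrow>
    (\<forall>A\<in>sets \<mu>. emeasure \<mu> A = (INF U\<in>{U. A \<subseteq> U \<and> open U}. emeasure \<mu> U))"

(* Membership in null_sets, rather than "emeasure = 0", because emeasure is 0 by
   convention on non-measurable sets. *)
definition pos_pointwise_expansive ::
    "('a::metric_space \<Rightarrow> 'a) \<Rightarrow> 'a measure \<Rightarrow> bool" where
  "pos_pointwise_expansive f \<mu> \<longleftrightarrow>
    borel_measure \<mu> \<and> non_atomic \<mu> \<and> (\<forall>x. \<exists>\<delta>>0. Phi f \<delta> x \<in> null_sets \<mu>)"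

end

theory Submission
  imports Defs
begin

text \<open>
  Every stable set is a null set, so countably many of them cannot cover a space of
  nonzero measure.

  The measure is not assumed invariant, so bounds on the orbits that hold only from some time
  \<open>n\<close> on cannot be moved back to time \<open>0\<close> by applying \<open>f\<close>. Instead, the first \<open>n\<close> steps are
  controlled locally, by continuity. Let \<open>y\<close> be stably equivalent to \<open>x\<close> and let
  \<open>\<delta>\<close> be such that \<open>Phi f \<delta> y\<close> is null. From some time \<open>n\<close> on, the orbits of \<open>x\<close>
  and \<open>y\<close> are \<open>\<delta>/2\<close>-close, and if \<open>z\<close> is another point with this property for the same \<open>n\<close>,
  then the orbits of \<open>y\<close> and \<open>z\<close> are \<open>\<delta>\<close>-close from time \<open>n\<close> on. If moreover \<open>z\<close> is
  near enough to \<open>y\<close>, they are \<open>\<delta>\<close>-close before time \<open>n\<close> too, so \<open>z \<in> Phi f \<delta> y\<close>.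
  Hence \<open>y\<close> has a neighbourhood in which the points that shadow \<open>x\<close> from time \<open>n\<close> on form a
  null set (\<open>null_neighbourhood_in_eventual_shadow\<close>). By separability that neighbourhood can be
  taken from a countable base, and the accuracy from a sequence tending to \<open>0\<close>; the choices are
  then countable in number, and \<open>stable_set_null\<close> follows.
\<close>

lemma separable_metric_countable_base:
  assumes "separable_space (euclidean :: 'a::metric_space topology)"
  obtains B :: "'a::metric_space set set"
  where "countable B" "\<And>b. b \<in> B \<Longrightarrow> open b"
    "\<And>x U. open U \<Longrightarrow> x \<in> U \<Longrightarrow> \<exists>b\<in>B. x \<in> b \<and> b \<subseteq> U"
proof -
  from assms obtain C :: "'a set" where C: "countable C" "closure C = UNIV"
    unfolding separable_space_def by auto
  let ?B = "(\<lambda>(c, k). ball c (inverse (real (Suc k)))) ` (C \<times> UNIV)"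
  show ?thesis
  proof
    show "countable ?B" using C(1) by blast
    show "open b" if "b \<in> ?B" for b using that by auto
    fix x :: 'a and U assume "open U" "x \<in> U"
    then obtain e where e: "e > 0" "ball x e \<subseteq> U" by (meson open_contains_ball)
    from e(1) obtain k where k: "inverse (real (Suc k)) < e / 2"
      using reals_Archimedean[of "e / 2"] by auto
    have "x \<in> closure C" "inverse (real (Suc k)) > 0" using C(2) by simp_all
    then obtain c where c: "c \<in> C" "dist c x < inverse (real (Suc k))"
      unfolding closure_approachable by blast
    have "ball c (inverse (real (Suc k))) \<subseteq> ball x e"
    proof
      fix z assume "z \<in> ball c (inverse (real (Suc k)))"
      then show "z \<in> ball x e"
        using c(2) k dist_triangle[of x z c] by (simp add: dist_commute)
    qed
    with e(2) have "ball c (inverse (real (Suc k))) \<subseteq> U" by (rule subset_trans[rotated])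
    moreover have "ball c (inverse (real (Suc k))) \<in> ?B"
      using c(1) by (intro image_eqI[of _ _ "(c, k)"]) auto
    moreover have "x \<in> ball c (inverse (real (Suc k)))" using c(2) by (simp only: mem_ball)
    ultimately show "\<exists>b\<in>?B. x \<in> b \<and> b \<subseteq> U" by (intro bexI conjI)
  qed
qed

lemma continuous_on_funpow:
  assumes "continuous_on UNIV (f :: 'a::topological_space \<Rightarrow> 'a::topological_space)"
  shows "continuous_on UNIV (f ^^ i)"
proof (induction i)
  case (Suc i)
  then show ?case
    using continuous_on_compose2[OF assms Suc] by (simp add: o_def)
qed simp

definition eventual_shadow :: "('a::metric_space \<Rightarrow> 'a) \<Rightarrow> real \<Rightarrow> nat \<Rightarrow> 'a \<Rightarrow> 'a set" where
  "eventual_shadow f \<epsilon> n x = {y. \<forall>i\<ge>n. dist ((f ^^ i) x) ((f ^^ i) y) \<le> \<epsilon>}"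

lemma closed_eventual_shadow:
  assumes "continuous_on UNIV f"
  shows "closed (eventual_shadow f \<epsilon> n x)"
  unfolding eventual_shadow_def
  by (intro closed_Collect_all closed_Collect_imp open_Collect_const closed_Collect_le
        continuous_intros continuous_on_funpow assms)

text \<open>
  Two points that shadow \<open>x\<close> from time \<open>n\<close> on shadow each other from time \<open>n\<close> on with twice the
  error; the finitely many earlier times are taken care of by continuity at \<open>y\<close>.
\<close>

lemma eventual_shadow_locally_in_Phi:
  assumes f: "continuous_on UNIV f" and "\<delta> > 0" "2 * \<epsilon> \<le> \<delta>" and y: "y \<in> eventual_shadow f \<epsilon> n x"
  obtains U where "open U" "y \<in> U" "U \<inter> eventual_shadow f \<epsilon> n x \<subseteq> Phi f \<delta> y"
proof
  let ?U = "\<Inter>i\<in>{..<n}. {z. dist ((f ^^ i) y) ((f ^^ i) z) < \<delta>}"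
  show "open ?U"
    by (intro open_INT finite_lessThan ballI open_Collect_less continuous_intros
        continuous_on_funpow f)
  show "y \<in> ?U" using \<open>\<delta> > 0\<close> by simp
  show "?U \<inter> eventual_shadow f \<epsilon> n x \<subseteq> Phi f \<delta> y"
  proof
    fix z assume z: "z \<in> ?U \<inter> eventual_shadow f \<epsilon> n x"
    have "dist ((f ^^ i) y) ((f ^^ i) z) \<le> \<delta>" for i
    proof (cases "i < n")
      case True
      then show ?thesis using z by force
    next
      case False
      then have "dist ((f ^^ i) x) ((f ^^ i) y) \<le> \<epsilon>" "dist ((f ^^ i) x) ((f ^^ i) z) \<le> \<epsilon>"
        using y z by (auto simp: eventual_shadow_def)
      then show ?thesis
        using dist_triangle3[of "(f ^^ i) y" "(f ^^ i) z" "(f ^^ i) x"] \<open>2 * \<epsilon> \<le> \<delta>\<close> by linarith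
    qed
    then show "z \<in> Phi f \<delta> y" by (simp add: Phi_def)
  qed
qed

text \<open>
  The accuracy is \<open>1 / (m + 1)\<close> rather than an arbitrary positive real, so that only countably many
  shadowing sets occur as \<open>y\<close> varies over the stable set.
\<close>

lemma null_neighbourhood_in_eventual_shadow:
  assumes f: "continuous_on UNIV f" and \<mu>: "pos_pointwise_expansive f \<mu>"
    and y: "y \<in> stable_set f x"
  obtains m n U where "open U" "y \<in> U" "y \<in> eventual_shadow f (inverse (real (Suc m))) n x"
    "U \<inter> eventual_shadow f (inverse (real (Suc m))) n x \<in> null_sets \<mu>"
proof -
  from \<mu> have sets: "sets \<mu> = sets borel"
    by (simp add: pos_pointwise_expansive_def borel_measure_def)
  from \<mu> obtain \<delta> where \<delta>: "\<delta> > 0" "Phi f \<delta> y \<in> null_sets \<mu>"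
    unfolding pos_pointwise_expansive_def by blast
  then obtain m where m: "inverse (real (Suc m)) < \<delta> / 2"
    using reals_Archimedean[of "\<delta> / 2"] by auto
  let ?\<epsilon> = "inverse (real (Suc m))"
  have "?\<epsilon> > 0" by simp
  with y obtain n where n: "y \<in> eventual_shadow f ?\<epsilon> n x"
    unfolding stable_set_def eventual_shadow_def by blast
  obtain U where U: "open U" "y \<in> U" "U \<inter> eventual_shadow f ?\<epsilon> n x \<subseteq> Phi f \<delta> y"
  proof (rule eventual_shadow_locally_in_Phi[OF f \<delta>(1) _ n])
    show "2 * ?\<epsilon> \<le> \<delta>" using m by linarith
  qed
  have "U \<inter> eventual_shadow f ?\<epsilon> n x \<in> sets \<mu>"
    unfolding sets using U(1) closed_eventual_shadow[OF f] by (intro sets.Int) auto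
  then show ?thesis
    using that U n null_sets_subset[OF \<delta>(2)] by blast
qed

lemma stable_set_null:
  assumes sep: "separable_space (euclidean :: 'a::metric_space topology)"
    and f: "continuous_on UNIV (f :: 'a::metric_space \<Rightarrow> 'a::metric_space)"
    and \<mu>: "pos_pointwise_expansive f \<mu>"
  obtains N where "N \<in> null_sets \<mu>" "stable_set f x \<subseteq> N"
proof -
  from \<mu> have sets: "sets \<mu> = sets borel"
    by (simp add: pos_pointwise_expansive_def borel_measure_def)
  from sep obtain B :: "'a set set" where B: "countable B" "\<And>b. b \<in> B \<Longrightarrow> open b"
    "\<And>x U. open U \<Longrightarrow> x \<in> U \<Longrightarrow> \<exists>b\<in>B. x \<in> b \<and> b \<subseteq> U"
    by (rule separable_metric_countable_base) blast
  define S where "S m n = eventual_shadow f (inverse (real (Suc m))) n x" for m n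
  let ?F = "(\<lambda>(b, m, n). b \<inter> S m n) ` (B \<times> UNIV \<times> UNIV) \<inter> null_sets \<mu>"
  show ?thesis
  proof
    have "countable ?F" using B(1) by (intro countable_Int1 countable_image countable_SIGMA) auto
    then show "\<Union>?F \<in> null_sets \<mu>"
      using null_sets_UN'[of ?F "\<lambda>s. s" \<mu>] by auto
    show "stable_set f x \<subseteq> \<Union>?F"
    proof
      fix y assume "y \<in> stable_set f x"
      then obtain m n U where U: "open U" "y \<in> U" "y \<in> S m n" "U \<inter> S m n \<in> null_sets \<mu>"
        unfolding S_def using null_neighbourhood_in_eventual_shadow[OF f \<mu>] by metis
      with B(3) obtain b where b: "b \<in> B" "y \<in> b" "b \<subseteq> U" by blast
      have "b \<inter> S m n \<in> sets \<mu>"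
        unfolding sets S_def using B(2)[OF b(1)] closed_eventual_shadow[OF f]
        by (intro sets.Int) auto
      with U(4) b(3) have "b \<inter> S m n \<in> null_sets \<mu>"
        using null_sets_subset[of "U \<inter> S m n" \<mu> "b \<inter> S m n"] by blast
      moreover have "b \<inter> S m n \<in> (\<lambda>(b, m, n). b \<inter> S m n) ` (B \<times> UNIV \<times> UNIV)"
        using b(1) by (intro image_eqI[of _ _ "(b, m, n)"]) auto
      ultimately have "b \<inter> S m n \<in> ?F" by (rule IntI[rotated])
      then show "y \<in> \<Union>?F" by (rule UnionI) (use b(2) U(3) in simp)
    qed
  qed
qed

theorem corollary3p11:
  fixes f :: "'a::metric_space \<Rightarrow> 'a" and \<mu> :: "'a measure"
  assumes "separable_space (euclidean :: 'a topology)"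
    and "continuous_on UNIV f"
    and "emeasure \<mu> (space \<mu>) \<noteq> 0"
    and "outer_regular_measure \<mu>"
    and "pos_pointwise_expansive f \<mu>"
  shows "uncountable (stable_classes f)"
proof
  assume count: "countable (stable_classes f)"
  have "\<exists>N\<in>null_sets \<mu>. W \<subseteq> N" if "W \<in> stable_classes f" for W
    using that stable_set_null[OF assms(1,2,5)] unfolding stable_classes_def by (metis rangeE)
  then obtain N where N: "\<And>W. W \<in> stable_classes f \<Longrightarrow> N W \<in> null_sets \<mu> \<and> W \<subseteq> N W"
    by metis
  have "(\<Union>W\<in>stable_classes f. N W) \<in> null_sets \<mu>"
    using count N by (intro null_sets_UN') auto
  moreover have "(\<Union>W\<in>stable_classes f. N W) = UNIV"
  proof -
    have "x \<in> stable_set f x" "stable_set f x \<in> stable_classes f" for x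
      by (auto simp: stable_set_def stable_classes_def)
    with N show ?thesis by blast
  qed
  moreover have "space \<mu> = UNIV"
    using assms(5) sets_eq_imp_space_eq[of \<mu> borel]
    by (simp add: pos_pointwise_expansive_def borel_measure_def)
  ultimately show False using assms(3) by auto
qed

end
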